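(* No deterministic truthful mechanism for the House Allocation problem can achieve an approximation ratio better than $2$; that is, for every deterministic truthful mechanism $\phi$ there is no constant $c<2$ such that $w(I)\le c\cdot w(\phi(I))$ for all instances $I$. The result holds even when attention is restricted to instances with strict preferences.
   Context: House Allocation (HA). An instance $I$ consists of a finite set $N$ of agents, a finite set $O$ of objects with $|O|=n_2$, and for each agent $i$ a preference list $L(i)=(C^i_1\succ_i C^i_2\succ_i\cdots)$, an ordered sequence of pairwise disjoint subsets of $O$ (indifference classes); objects in $C^i_k$ are strictly preferred to those in $C^i_l$ for $k<l$, and $i$ is indifferent between objects in the same class. Preferences are strict if all classes have at most one element. Objects in $\bigcup_k C^i_k$ are acceptable to $i$. $rank(i,o)=k$ if $o\in C^i_k$, and $n_2+1$ if $o$ is unacceptable or if $i$ is unmatched; $i$ prefers smaller rank. A matching is a set of (agent, acceptable object) pairs in which every agent and every object occurs at most once. Agents may have positive weights (all equal to $1$ in the unweighted case); the weight $w(\mu)$ of a matching is the sum of the weights of matched agents, and $w(I)$ is the maximum weight of a matching in $I$. A deterministic mechanism maps each instance to a matching; it is truthful if for all profiles $L$, agents $i$ and lists $L'(i)$, agent $i$ weakly prefers, according to $L(i)$, his outcome under $\phi(L(i),L(-i))$ to his outcome under $\phi(L'(i),L(-i))$. The approximation ratio of $\phi$ is $\max_I w(I)/w(\phi(I))$ over all instances $I$. *)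

theory Defs
  imports Complex_Main "HOL-Library.Infinite_Typeclass"
begin

text \<open>
  Agents and objects are named by elements of two arbitrary types, and each instance picks finite
  sets of them. The values of \<open>pref\<close> and \<open>weight\<close> outside \<open>agents\<close> are irrelevant.
  An entry \<open>pref I i\<close> lists the indifference classes of agent \<open>i\<close>, best class first.
\<close>

record ('a, 'o) ha_instance =
  agents :: "'a set"
  objects :: "'o set"
  pref :: "'a \<Rightarrow> 'o set list"
  weight :: "'a \<Rightarrow> real"

text \<open>
  Classes are required to be nonempty, so a list has at most \<open>card X\<close> classes. This makes
  the rank \<open>card X + 1\<close>, which encodes ``unacceptable or unmatched'', worse than the
  rank of every acceptable object.
\<close>

definition pref_list :: "'o set \<Rightarrow> 'o set list \<Rightarrow> bool" where
  "pref_list X L \<longleftrightarrow>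
     (\<forall>C\<in>set L. C \<subseteq> X \<and> C \<noteq> {}) \<and>
     (\<forall>k l. k < l \<and> l < length L \<longrightarrow> L ! k \<inter> L ! l = {})"

definition HA :: "('a, 'o) ha_instance set" where
  "HA = {I. finite (agents I) \<and> finite (objects I) \<and>
            (\<forall>i\<in>agents I. pref_list (objects I) (pref I i) \<and> 0 < weight I i)}"

definition strict_prefs :: "('a, 'o) ha_instance \<Rightarrow> bool" where
  "strict_prefs I \<longleftrightarrow> (\<forall>i\<in>agents I. \<forall>C\<in>set (pref I i). card C \<le> 1)"

definition unweighted :: "('a, 'o) ha_instance \<Rightarrow> bool" where
  "unweighted I \<longleftrightarrow> (\<forall>i\<in>agents I. weight I i = 1)"

definition acceptable :: "('a, 'o) ha_instance \<Rightarrow> 'a \<Rightarrow> 'o \<Rightarrow> bool" where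
  "acceptable I i x \<longleftrightarrow> x \<in> \<Union> (set (pref I i))"

text \<open>Ranks are counted from 1, while list positions are counted from 0.
  The outcome \<open>None\<close> means that the agent is unmatched.\<close>

definition rank :: "('a, 'o) ha_instance \<Rightarrow> 'a \<Rightarrow> 'o option \<Rightarrow> nat" where
  "rank I i y = (case y of
       None \<Rightarrow> card (objects I) + 1
     | Some x \<Rightarrow>
         if acceptable I i x
         then (THE k. 1 \<le> k \<and> k \<le> length (pref I i) \<and> x \<in> pref I i ! (k - 1))
         else card (objects I) + 1)"

definition weakly_prefers ::
  "('a, 'o) ha_instance \<Rightarrow> 'a \<Rightarrow> 'o option \<Rightarrow> 'o option \<Rightarrow> bool" where
  "weakly_prefers I i y z \<longleftrightarrow> rank I i y \<le> rank I i z"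

definition matching :: "('a, 'o) ha_instance \<Rightarrow> ('a \<times> 'o) set \<Rightarrow> bool" where
  "matching I \<mu> \<longleftrightarrow>
     (\<forall>(i, x)\<in>\<mu>. i \<in> agents I \<and> x \<in> objects I \<and> acceptable I i x) \<and>
     inj_on fst \<mu> \<and> inj_on snd \<mu>"

definition outcome :: "('a \<times> 'o) set \<Rightarrow> 'a \<Rightarrow> 'o option" where
  "outcome \<mu> i = (if \<exists>x. (i, x) \<in> \<mu> then Some (THE x. (i, x) \<in> \<mu>) else None)"

definition matching_weight :: "('a, 'o) ha_instance \<Rightarrow> ('a \<times> 'o) set \<Rightarrow> real" where
  "matching_weight I \<mu> = (\<Sum>i\<in>fst ` \<mu>. weight I i)"

definition max_weight :: "('a, 'o) ha_instance \<Rightarrow> real" where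
  "max_weight I = Max (matching_weight I ` {\<mu>. matching I \<mu>})"

text \<open>Mechanisms and truthfulness are relative to a class \<open>D\<close> of instances; only
  misreports that stay inside \<open>D\<close> count as deviations.\<close>

definition mechanism ::
  "('a, 'o) ha_instance set \<Rightarrow> (('a, 'o) ha_instance \<Rightarrow> ('a \<times> 'o) set) \<Rightarrow> bool" where
  "mechanism D \<phi> \<longleftrightarrow> (\<forall>I\<in>D. matching I (\<phi> I))"

definition truthful ::
  "('a, 'o) ha_instance set \<Rightarrow> (('a, 'o) ha_instance \<Rightarrow> ('a \<times> 'o) set) \<Rightarrow> bool" where
  "truthful D \<phi> \<longleftrightarrow>
     (\<forall>I\<in>D. \<forall>i\<in>agents I. \<forall>L'. I\<lparr>pref := (pref I)(i := L')\<rparr> \<in> D \<longrightarrow>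
        weakly_prefers I i (outcome (\<phi> I) i)
          (outcome (\<phi> (I\<lparr>pref := (pref I)(i := L')\<rparr>)) i))"

end

theory Submission
  imports Defs
begin

text \<open>
  Two agents both rank \<open>x\<close> above \<open>y\<close>. A ratio below 2 forces the mechanism to match both agents
  whenever this is possible, so some agent \<open>i\<close> receives \<open>y\<close>. If \<open>i\<close> claims instead that only \<open>x\<close>
  is acceptable, both agents can still be matched, hence must be, and \<open>i\<close> receives \<open>x\<close>.
\<close>

text \<open>Finiteness makes the \<open>Max\<close> in \<open>max_weight\<close> an upper bound for
  the weight of every matching.\<close>

lemma finite_matchings:
  assumes "I \<in> HA"
  shows "finite {\<mu>. matching I \<mu>}"
proof (rule finite_subset)
  show "{\<mu>. matching I \<mu>} \<subseteq> Pow (agents I \<times> objects I)"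
    by (auto simp: matching_def)
  show "finite (Pow (agents I \<times> objects I))"
    using assms by (simp add: HA_def)
qed

lemma matching_weight_le_max_weight:
  assumes "I \<in> HA" "matching I \<mu>"
  shows "matching_weight I \<mu> \<le> max_weight I"
  unfolding max_weight_def using assms finite_matchings by (intro Max_ge) auto

lemma outcome_eq_Some:
  assumes "inj_on fst \<mu>" "(i, x) \<in> \<mu>"
  shows "outcome \<mu> i = Some x"
proof -
  have "z = x" if "(i, z) \<in> \<mu>" for z
    using inj_onD[OF assms(1) _ that assms(2)] by simp
  then have "(THE z. (i, z) \<in> \<mu>) = x"
    using assms(2) by (intro the_equality)
  then show ?thesis using assms(2) by (auto simp: outcome_def)
qed

text \<open>Disjointness of the classes leaves only one candidate for the definite description in
  \<open>rank\<close>. The shift by 1 turns list positions into ranks.\<close>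

lemma rank_nth:
  assumes "pref_list (objects I) (pref I i)" "k < length (pref I i)" "x \<in> pref I i ! k"
  shows "rank I i (Some x) = k + 1"
proof -
  have "acceptable I i x"
    using assms(2,3) by (auto simp: acceptable_def)
  moreover have "m = k + 1"
    if m: "1 \<le> m" "m \<le> length (pref I i)" "x \<in> pref I i ! (m - 1)" for m
  proof (rule ccontr)
    assume "m \<noteq> k + 1"
    \<comment> \<open>The bound \<open>1 \<le> m\<close> matters here: truncated subtraction would
      otherwise let \<open>m = 0\<close> and \<open>k = 0\<close> give the same position.\<close>
    then have "m - 1 < k \<or> k < m - 1" using m(1) by linarith
    moreover have "m - 1 < length (pref I i)" using m by linarith
    ultimately have "pref I i ! (m - 1) \<inter> pref I i ! k = {}"
      using assms(1,2) unfolding pref_list_def by (metis inf_commute)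
    then show False using m(3) assms(3) by blast
  qed
  then have "(THE m. 1 \<le> m \<and> m \<le> length (pref I i) \<and> x \<in> pref I i ! (m - 1)) = k + 1"
    using assms(2,3) by (intro the_equality) simp_all
  ultimately show ?thesis by (simp add: rank_def)
qed

text \<open>The optimum is at least 2, while a matching that leaves an agent out weighs at most 1,
  and a factor below 2 cannot bridge this gap.\<close>

lemma ratio_less_2_matches_both:
  assumes "I \<in> HA" "unweighted I" "agents I = {i, j}" "i \<noteq> j"
    and "matching I {(i, u), (j, v)}" "matching I \<mu>"
    and "c < 2" "max_weight I \<le> c * matching_weight I \<mu>"
  shows "fst ` \<mu> = {i, j}"
proof (rule ccontr)
  assume "fst ` \<mu> \<noteq> {i, j}"
  moreover have sub: "fst ` \<mu> \<subseteq> {i, j}"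
    using assms(3,6) by (auto simp: matching_def)
  ultimately have "card (fst ` \<mu>) < card {i, j}"
    by (intro psubset_card_mono psubsetI) simp_all
  then have "card (fst ` \<mu>) \<le> 1" using \<open>i \<noteq> j\<close> by simp
  moreover have "matching_weight I \<mu> = card (fst ` \<mu>)"
  proof -
    have "weight I k = 1" if "k \<in> fst ` \<mu>" for k
      using assms(2,3) sub that unfolding unweighted_def by blast
    then show ?thesis by (simp add: matching_weight_def)
  qed
  ultimately have w: "0 \<le> matching_weight I \<mu>" "matching_weight I \<mu> \<le> 1" by auto
  have "matching_weight I {(i, u), (j, v)} = 2"
    using assms(2,3,4) by (simp add: matching_weight_def unweighted_def)
  then have "2 \<le> c * matching_weight I \<mu>"
    using matching_weight_le_max_weight[OF assms(1,5)] assms(8) by linarith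
  \<comment> \<open>Multiplying by the nonnegative weight avoids any assumption on the sign of
    \<open>c\<close>. The resulting bound also excludes weight 0, and weight 1 would give
    \<open>2 \<le> c\<close>.\<close>
  moreover have "c * matching_weight I \<mu> \<le> 2 * matching_weight I \<mu>"
    using w(1) \<open>c < 2\<close> by (intro mult_right_mono) auto
  ultimately have "matching_weight I \<mu> = 1" using w(2) by linarith
  then show False using \<open>2 \<le> c * matching_weight I \<mu>\<close> \<open>c < 2\<close> by simp
qed

theorem theorem2p3:
  fixes D :: "('a::infinite, 'o::infinite) ha_instance set"
    and \<phi> :: "('a, 'o) ha_instance \<Rightarrow> ('a \<times> 'o) set"
  assumes "D \<in> {HA,
                {I \<in> HA. strict_prefs I},
                {I \<in> HA. unweighted I},
                {I \<in> HA. unweighted I \<and> strict_prefs I}}"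
    and "mechanism D \<phi>"
    and "truthful D \<phi>"
  shows "\<not> (\<exists>c<2. \<forall>I\<in>D. max_weight I \<le> c * matching_weight I (\<phi> I))"
proof
  assume "\<exists>c<2. \<forall>I\<in>D. max_weight I \<le> c * matching_weight I (\<phi> I)"
  then obtain c where c: "c < 2" "\<And>I. I \<in> D \<Longrightarrow> max_weight I \<le> c * matching_weight I (\<phi> I)"
    by blast
  \<comment> \<open>All four choices of \<open>D\<close> contain the unweighted strict instances.
    Both instances built below are of this kind, so one argument serves every
    \<open>D\<close>.\<close>
  have D: "I \<in> D" if "I \<in> HA" "unweighted I" "strict_prefs I" for I
    using assms(1) that by auto
  have \<phi>: "matching I (\<phi> I)" if "I \<in> D" for I
    using assms(2) that by (simp add: mechanism_def)
  obtain a b :: 'a where ab: "a \<noteq> b"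
    using ex_new_if_finite[OF infinite_UNIV, of "{undefined}"] by auto
  obtain x y :: 'o where xy: "x \<noteq> y"
    using ex_new_if_finite[OF infinite_UNIV, of "{undefined}"] by auto

  define I :: "('a, 'o) ha_instance" where
    "I = \<lparr>agents = {a, b}, objects = {x, y}, pref = (\<lambda>_. [{x}, {y}]), weight = (\<lambda>_. 1)\<rparr>"
  have pl: "pref_list {x, y} [{x}, {y}]" "pref_list {x, y} [{x}]"
    using xy by (auto simp: pref_list_def nth_Cons split: nat.splits)
  have I: "I \<in> HA" "unweighted I" "strict_prefs I"
    using pl by (auto simp: I_def HA_def unweighted_def strict_prefs_def)
  have "matching I {(a, x), (b, y)}"
    using ab xy by (auto simp: I_def matching_def acceptable_def)
  then have both: "fst ` \<phi> I = {a, b}"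
    using ratio_less_2_matches_both[OF I(1,2) _ ab _ \<phi>[OF D[OF I]] c(1) c(2)[OF D[OF I]]]
    by (auto simp: I_def)
  obtain u v where uv: "(a, u) \<in> \<phi> I" "(b, v) \<in> \<phi> I"
  proof -
    have "a \<in> fst ` \<phi> I" "b \<in> fst ` \<phi> I" using both by auto
    then show thesis using that by force
  qed
  have "u \<noteq> v"
    using \<phi>[OF D[OF I]] uv ab inj_onD[of snd "\<phi> I" "(a, u)" "(b, v)"] by (auto simp: matching_def)
  moreover have "u \<in> {x, y}" "v \<in> {x, y}"
    using \<phi>[OF D[OF I]] uv by (auto simp: matching_def I_def)
  \<comment> \<open>The mechanism decides who receives \<open>y\<close>; renaming that agent
    \<open>i\<close> treats both cases at once.\<close>
  ultimately obtain i j where ij: "{a, b} = {i, j}" "i \<noteq> j" "(i, y) \<in> \<phi> I"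
    using uv ab that[of a b] that[of b a] by auto

  define J where "J = I\<lparr>pref := (pref I)(i := [{x}])\<rparr>"
  have J: "J \<in> HA" "unweighted J" "strict_prefs J"
    using pl by (auto simp: J_def I_def HA_def unweighted_def strict_prefs_def)
  have agJ: "agents J = {i, j}" using ij(1) by (simp add: J_def I_def)
  \<comment> \<open>Agent \<open>j\<close> keeps the old list and so still accepts
    \<open>y\<close>.\<close>
  have "matching J {(i, x), (j, y)}"
    unfolding matching_def agJ using ij(2) xy by (auto simp: J_def I_def acceptable_def)
  then have "fst ` \<phi> J = {i, j}"
    using ratio_less_2_matches_both[OF J(1,2) agJ ij(2) _ \<phi>[OF D[OF J]] c(1) c(2)[OF D[OF J]]]
    by blast
  then have "i \<in> fst ` \<phi> J" by simp
  then obtain z where "(i, z) \<in> \<phi> J" by auto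
  moreover from this have "acceptable J i z"
    using \<phi>[OF D[OF J]] by (auto simp: matching_def)
  ultimately have ix: "(i, x) \<in> \<phi> J" by (simp add: acceptable_def J_def)

  have "outcome (\<phi> I) i = Some y" "outcome (\<phi> J) i = Some x"
    using outcome_eq_Some ij(3) ix \<phi>[OF D[OF I]] \<phi>[OF D[OF J]] by (auto simp: matching_def)
  \<comment> \<open>The true list of \<open>i\<close> is the one in \<open>I\<close>, so both
    outcomes are ranked there; truthfulness then demands \<open>2 \<le> 1\<close>.\<close>
  moreover have "weakly_prefers I i (outcome (\<phi> I) i) (outcome (\<phi> J) i)"
  proof -
    have "i \<in> agents I" using ij(1) by (simp add: I_def)
    then show ?thesis
      using assms(3) D[OF I] D[OF J] unfolding truthful_def J_def by blast
  qed
  moreover have "rank I i (Some x) = 1" "rank I i (Some y) = 2"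
    using rank_nth[of I i 0 x] rank_nth[of I i 1 y] pl(1) by (simp_all add: I_def)
  ultimately show False by (simp add: weakly_prefers_def)
qed

end
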